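(* There exists a bijective Costas cloud on $\mathbb{R}\times(0,1)$, i.e. a bijection $h:\mathbb{R}\to(0,1)$ that is discontinuous at every point of $\mathbb{R}$, whose graph is dense in $\mathbb{R}\times(0,1)$, and such that for all $x,y\in\mathbb{R}$ and all $t\in\mathbb{R}\setminus\{0\}$, $h(x+t)-h(x)=h(y+t)-h(y)$ implies $x=y$.
   Context: For intervals $A,B\subseteq\mathbb{R}$, a Costas cloud on $A\times B$ is an injection $f:A\to B$ which is discontinuous at every point of $A$, whose graph $\{(x,f(x)):x\in A\}$ is dense in $A\times B$, and which has the Costas property with respect to $T=\{t\in\mathbb{R}\setminus\{0\}:(t+A)\cap A\neq\emptyset\}$: for all $a_1,a_2\in A$ and $t\in T$ with $t+a_1,t+a_2\in A$, $f(t+a_1)+f(a_2)=f(t+a_2)+f(a_1)$ implies $a_1=a_2$. It is a bijective Costas cloud if moreover $f$ is a bijection onto $B$. *)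

theory Defs
  imports "HOL-Analysis.Analysis"
begin

definition costas_translations :: "real set \<Rightarrow> real set" where
  "costas_translations A = {t. t \<noteq> 0 \<and> ((+) t ` A) \<inter> A \<noteq> {}}"

definition costas_property :: "real set \<Rightarrow> real set \<Rightarrow> (real \<Rightarrow> real) \<Rightarrow> bool" where
  "costas_property T A f \<longleftrightarrow>
     (\<forall>a\<^sub>1\<in>A. \<forall>a\<^sub>2\<in>A. \<forall>t\<in>T. t + a\<^sub>1 \<in> A \<longrightarrow> t + a\<^sub>2 \<in> A \<longrightarrow>
        f (t + a\<^sub>1) + f a\<^sub>2 = f (t + a\<^sub>2) + f a\<^sub>1 \<longrightarrow> a\<^sub>1 = a\<^sub>2)"

text \<open>A map from \<open>A\<close> to \<open>B\<close> is a total function of which only the values on \<open>A\<close> matter;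
  continuity and the graph are therefore taken relative to \<open>A\<close>.\<close>

definition costas_cloud :: "real set \<Rightarrow> real set \<Rightarrow> (real \<Rightarrow> real) \<Rightarrow> bool" where
  "costas_cloud A B f \<longleftrightarrow>
     is_interval A \<and> is_interval B \<and>
     f ` A \<subseteq> B \<and> inj_on f A \<and>
     (\<forall>x\<in>A. \<not> continuous (at x within A) f) \<and>
     A \<times> B \<subseteq> closure {(x, f x) | x. x \<in> A} \<and>
     costas_property (costas_translations A) A f"

definition bijective_costas_cloud :: "real set \<Rightarrow> real set \<Rightarrow> (real \<Rightarrow> real) \<Rightarrow> bool" where
  "bijective_costas_cloud A B f \<longleftrightarrow> costas_cloud A B f \<and> bij_betw f A B"

lemma bijective_costas_cloud_UNIV_iff:
  "bijective_costas_cloud UNIV {0<..<1} h \<longleftrightarrow>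
     bij_betw h UNIV {0<..<1} \<and>
     (\<forall>x. \<not> isCont h x) \<and>
     UNIV \<times> {0<..<1} \<subseteq> closure {(x, h x) | x. True} \<and>
     (\<forall>x y t. t \<noteq> 0 \<longrightarrow> h (x + t) - h x = h (y + t) - h y \<longrightarrow> x = y)"
proof -
  have T: "costas_translations UNIV = {t. t \<noteq> 0}"
    by (auto simp: costas_translations_def)
  have eq: "h (t + x) + h y = h (t + y) + h x \<longleftrightarrow> h (x + t) - h x = h (y + t) - h y" for x y t
    by (auto simp: algebra_simps)
  have P: "costas_property (costas_translations UNIV) UNIV h \<longleftrightarrow>
     (\<forall>x y t. t \<noteq> 0 \<longrightarrow> h (x + t) - h x = h (y + t) - h y \<longrightarrow> x = y)"
    unfolding costas_property_def T eq by blast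
  have B: "h ` UNIV \<subseteq> {0<..<1}" "inj h" if "bij_betw h UNIV {0<..<1}"
    using that by (simp_all add: bij_betw_def)
  show ?thesis
    unfolding bijective_costas_cloud_def costas_cloud_def P
    using B by (simp add: is_interval_univ is_interval_oo) blast
qed

end

theory Submission
  imports Defs
begin

text \<open>
  A bijection \<open>h\<close> has the Costas property iff its graph is a Sidon set in \<open>\<real>\<^sup>2\<close>. A Sidon graph is
  built by transfinite recursion, meeting at most continuum many sets: the vertical lines, the
  horizontal lines and a countable family of open sets. At each stage fewer than continuum many
  points have been chosen. A new point can violate the Sidon condition only if both of its
  coordinates are determined by those of earlier points through \<open>x + x = b + c\<close> or
  \<open>x + d = b + c\<close>; hence one free coordinate always suffices.
\<close>

section \<open>Cardinality\<close>

lemma lesspoll_iff_card_of_ordLess: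
  includes cardinal_syntax
  shows "A \<prec> B \<longleftrightarrow> |A| <o |B|"
  unfolding lesspoll_def lepoll_def eqpoll_iff_card_of_ordIso card_of_ordLeq
  using ordLess_imp_ordLeq not_ordLess_ordIso ordLeq_iff_ordLess_or_ordIso by blast

lemma ex_well_order_on_underS_lesspoll:
  obtains r where "well_order_on A r" "\<And>a. a \<in> A \<Longrightarrow> underS r a \<prec> A"
proof
  show "well_order_on A (card_of A)"
    by (rule card_of_well_order_on)
  show "underS (card_of A) a \<prec> A" if "a \<in> A" for a
    using that card_of_underS[OF card_of_Card_order, of a A]
    by (simp add: lesspoll_iff_card_of_ordLess Field_card_of)
qed

lemma image_lesspoll: "A \<prec> X \<Longrightarrow> f ` A \<prec> X"
  using image_lepoll lesspoll_trans1 by blast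

lemma Un_lepoll_infinite: "infinite X \<Longrightarrow> A \<lesssim> X \<Longrightarrow> B \<lesssim> X \<Longrightarrow> A \<union> B \<lesssim> X"
  using card_of_Un_ordLeq_infinite_Field[of "card_of X" A B]
  by (simp add: lepoll_def card_of_ordLeq Field_card_of card_of_card_order_on)

lemma Un_lesspoll_infinite: "infinite X \<Longrightarrow> A \<prec> X \<Longrightarrow> B \<prec> X \<Longrightarrow> A \<union> B \<prec> X"
  by (simp add: lesspoll_iff_card_of_ordLess card_of_Un_ordLess_infinite)

lemma Times_lesspoll_infinite:
  assumes "infinite X" "A \<prec> X" "B \<prec> X"
  shows "A \<times> B \<prec> X"
proof -
  let ?C = "A <+> B"
  have C: "?C \<prec> X"
    using assms by (simp add: lesspoll_iff_card_of_ordLess card_of_Plus_ordLess_infinite)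
  have "A \<times> B \<lesssim> ?C \<times> ?C"
    by (intro times_lepoll_mono) (auto simp: lepoll_def intro!: exI[of _ Inl] exI[of _ Inr])
  also have "?C \<times> ?C \<prec> X"
  proof (cases "finite ?C")
    case True
    then show ?thesis
      using assms(1) by (intro finite_lesspoll_infinite finite_SigmaI)
  next
    case False
    then have "?C \<times> ?C \<approx> ?C"
      unfolding eqpoll_iff_card_of_ordIso by (rule card_of_Times_same_infinite)
    then show ?thesis
      using C by (rule eq_lesspoll_trans)
  qed
  finally show ?thesis .
qed

lemma countable_lepoll_infinite:
  assumes "countable A" "infinite X"
  shows "A \<lesssim> X"
proof -
  have "A \<lesssim> (UNIV :: nat set)"
    using assms(1) unfolding countable_def lepoll_def by blast
  also have "\<dots> \<lesssim> X"
    using assms(2) by (simp add: infinite_le_lepoll)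
  finally show ?thesis .
qed

lemma open_eqpoll_reals:
  fixes U :: "real set"
  assumes "open U" "U \<noteq> {}"
  shows "U \<approx> (UNIV :: real set)"
proof -
  obtain x where "x \<in> U"
    using assms(2) by blast
  then obtain e where "0 < e" "ball x e \<subseteq> U"
    using assms(1) open_contains_ball by blast
  then show ?thesis
    by (intro eqpoll_real_subset[of "x - e" "x + e"]) (auto simp: dist_real_def subset_iff)
qed

section \<open>Properties of finite character\<close>

definition finite_character :: "('a set \<Rightarrow> bool) \<Rightarrow> bool" where
  "finite_character P \<longleftrightarrow> (\<forall>G. P G \<longleftrightarrow> (\<forall>F\<subseteq>G. finite F \<longrightarrow> P F))"

lemma finite_characterI:
  assumes antimono: "\<And>F G. P G \<Longrightarrow> F \<subseteq> G \<Longrightarrow> P F"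
    and finite_subsets: "\<And>G. (\<And>F. F \<subseteq> G \<Longrightarrow> finite F \<Longrightarrow> P F) \<Longrightarrow> P G"
  shows "finite_character P"
  unfolding finite_character_def
proof (intro allI iffI impI)
  show "P F" if "P G" "F \<subseteq> G" for F G
    using that by (rule antimono)
  show "P G" if "\<forall>F\<subseteq>G. finite F \<longrightarrow> P F" for G
    by (rule finite_subsets) (use that in simp)
qed

lemma finite_character_iff:
  "finite_character P \<Longrightarrow> P G \<longleftrightarrow> (\<forall>F\<subseteq>G. finite F \<longrightarrow> P F)"
  unfolding finite_character_def by (rule spec)

lemma finite_characterD:
  "finite_character P \<Longrightarrow> (\<And>F. F \<subseteq> G \<Longrightarrow> finite F \<Longrightarrow> P F) \<Longrightarrow> P G"
  by (rule finite_character_iff[THEN iffD2]) auto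

lemma finite_character_antimono:
  assumes "finite_character P" "P G" "F \<subseteq> G"
  shows "P F"
  using assms finite_character_iff[of P G] finite_character_iff[of P F] by (meson subset_trans)

lemma finite_character_conj:
  assumes "finite_character P" "finite_character Q"
  shows "finite_character (\<lambda>G. P G \<and> Q G)"
proof (rule finite_characterI)
  show "P F \<and> Q F" if "P G \<and> Q G" "F \<subseteq> G" for F G
    using that assms[THEN finite_character_antimono, of G F] by simp
  show "P G \<and> Q G" if "\<And>F. F \<subseteq> G \<Longrightarrow> finite F \<Longrightarrow> P F \<and> Q F" for G
    using that assms[THEN finite_characterD, of G] by simp
qed

lemma finite_character_subset: "finite_character (\<lambda>G. G \<subseteq> A)"
proof (rule finite_characterI)
  fix G assume "\<And>F. F \<subseteq> G \<Longrightarrow> finite F \<Longrightarrow> F \<subseteq> A"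
  from this[of "{_}"] show "G \<subseteq> A"
    by blast
qed blast

lemma finite_character_inj_on: "finite_character (inj_on f)"
proof (rule finite_characterI)
  fix G assume finite_subsets: "\<And>F. F \<subseteq> G \<Longrightarrow> finite F \<Longrightarrow> inj_on f F"
  show "inj_on f G"
  proof (rule inj_onI)
    fix x y assume xy: "x \<in> G" "y \<in> G" "f x = f y"
    have "inj_on f {x, y}"
      by (rule finite_subsets) (use xy in simp_all)
    then show "x = y"
      using xy(3) by (rule inj_onD) simp_all
  qed
qed (rule inj_on_subset)

lemma finite_character_Union_chain:
  assumes P: "finite_character P" "P {}"
    and chain: "subset.chain UNIV \<G>" and P_members: "\<And>G. G \<in> \<G> \<Longrightarrow> P G"
  shows "P (\<Union>\<G>)"
proof -
  have "P F" if F: "F \<subseteq> \<Union>\<G>" "finite F" for F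
  proof (cases "\<G> = {}")
    case False
    then obtain G where "G \<in> \<G>" "F \<subseteq> G"
      using finite_subset_Union_chain[OF F(2,1) _ chain] by blast
    with P_members show ?thesis
      using finite_character_antimono[OF P(1)] by blast
  qed (use F(1) P(2) in simp)
  then show ?thesis
    by (rule finite_characterD[OF P(1)])
qed

context wo_rel
begin

lemma under_eq_insert_underS: "a \<in> Field r \<Longrightarrow> under a = insert a (underS a)"
  using REFL by (auto simp: under_def underS_def refl_on_def)

lemma finite_character_image_under:
  assumes P: "finite_character P" "P {}"
    and "A \<subseteq> Field r" and P_under: "\<And>a. a \<in> A \<Longrightarrow> P (f ` under a)"
  shows "P (f ` A)"
proof -
  have "under a \<subseteq> under b \<or> under b \<subseteq> under a" if "a \<in> A" "b \<in> A" for a b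
    using that \<open>A \<subseteq> Field r\<close> TOTALS under_incr[OF TRANS] by blast
  then have "f ` under a \<subseteq> f ` under b \<or> f ` under b \<subseteq> f ` under a"
    if "a \<in> A" "b \<in> A" for a b
    using that image_mono by metis
  then have "subset.chain UNIV ((\<lambda>a. f ` under a) ` A)"
    by (auto simp: subset_chain_def)
  then have "P (\<Union>a\<in>A. f ` under a)"
    using P_under by (intro finite_character_Union_chain[OF P]) auto
  moreover have "f ` A \<subseteq> (\<Union>a\<in>A. f ` under a)"
    using \<open>A \<subseteq> Field r\<close> under_eq_insert_underS by blast
  ultimately show ?thesis
    by (rule finite_character_antimono[OF P(1)])
qed

lemma ex_choice_finite_character:
  fixes P :: "'b set \<Rightarrow> bool" and C :: "'a \<Rightarrow> 'b set"
  assumes P: "finite_character P" "P {}"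
    and extend: "\<And>f a. a \<in> Field r \<Longrightarrow> P (f ` underS a) \<Longrightarrow> \<exists>q\<in>C a. P (insert q (f ` underS a))"
  obtains f where "P (f ` Field r)" "\<And>a. a \<in> Field r \<Longrightarrow> f a \<in> C a"
proof -
  let ?Q = "\<lambda>f a q. a \<in> Field r \<longrightarrow> q \<in> C a \<and> P (insert q (f ` underS a))"
  have "\<exists>f. \<forall>a. ?Q f a (f a)"
  proof (rule dependent_wf_choice[OF WF])
    fix f g :: "'a \<Rightarrow> 'b" and a q
    assume "\<And>b. (b, a) \<in> r - Id \<Longrightarrow> f b = g b"
    then have "f ` underS a = g ` underS a"
      by (intro image_cong) (auto simp: underS_def)
    then show "?Q f a q = ?Q g a q" by simp
  next
    fix a and f :: "'a \<Rightarrow> 'b"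
    assume IH: "\<And>b. (b, a) \<in> r - Id \<Longrightarrow> ?Q f b (f b)"
    have "P (f ` under b)" if "b \<in> underS a" for b
    proof -
      have "(b, a) \<in> r - Id" "b \<in> Field r"
        using that by (auto simp: underS_def FieldI1)
      then show ?thesis
        using IH by (simp add: under_eq_insert_underS)
    qed
    then have "P (f ` underS a)"
      using finite_character_image_under[OF P] by (metis subsetI underS_Field)
    then show "\<exists>q. ?Q f a q"
      using extend by blast
  qed
  then obtain f where f: "\<And>a. a \<in> Field r \<Longrightarrow> f a \<in> C a \<and> P (insert (f a) (f ` underS a))"
    by blast
  then have "P (f ` Field r)"
    by (intro finite_character_image_under[OF P subset_refl]) (simp add: under_eq_insert_underS)
  with f show thesis
    using that by blast
qed

end

lemma transfinite_selection:
  fixes P :: "'a set \<Rightarrow> bool" and \<C> :: "'a set set"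
  assumes P: "finite_character P" "P {}"
    and extend: "\<And>C G. C \<in> \<C> \<Longrightarrow> P G \<Longrightarrow> G \<prec> \<C> \<Longrightarrow> \<exists>q\<in>C. P (insert q G)"
  obtains G where "P G" "\<And>C. C \<in> \<C> \<Longrightarrow> G \<inter> C \<noteq> {}"
proof -
  obtain r where r: "well_order_on \<C> r" and small: "\<And>C. C \<in> \<C> \<Longrightarrow> underS r C \<prec> \<C>"
    using ex_well_order_on_underS_lesspoll by blast
  have Field: "Field r = \<C>"
    using well_order_on_Well_order[OF r] by simp
  interpret wo_rel r
    using r Field by (simp add: wo_rel_def)
  obtain f where "P (f ` \<C>)" "\<And>C. C \<in> \<C> \<Longrightarrow> f C \<in> C"
    by (rule ex_choice_finite_character[OF P, of "\<lambda>C. C", unfolded Field])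
      (use extend small image_lesspoll in blast)+
  then show thesis
    using that[of "f ` \<C>"] by blast
qed

section \<open>Sidon sets\<close>

definition sidon_set :: "'a::plus set \<Rightarrow> bool" where
  "sidon_set S \<longleftrightarrow> (\<forall>p\<in>S. \<forall>q\<in>S. \<forall>r\<in>S. \<forall>s\<in>S. p + s = q + r \<longrightarrow> p = q \<or> p = r)"

lemma finite_character_sidon_set: "finite_character sidon_set"
proof (rule finite_characterI)
  fix G :: "'a set" assume finite_subsets: "\<And>F. F \<subseteq> G \<Longrightarrow> finite F \<Longrightarrow> sidon_set F"
  have "sidon_set {p, q, r, s}" if "p \<in> G" "q \<in> G" "r \<in> G" "s \<in> G" for p q r s
    using finite_subsets that by simp
  then show "sidon_set G"
    unfolding sidon_set_def by (meson insertCI)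
qed (unfold sidon_set_def, meson subsetD)

definition sidon_completions :: "'a::plus set \<Rightarrow> 'a set" where
  "sidon_completions S = {p. \<exists>q\<in>S. \<exists>r\<in>S. p + p = q + r \<or> (\<exists>s\<in>S. p + s = q + r)}"

lemma subset_sidon_completions: "S \<subseteq> sidon_completions S"
  by (auto simp: sidon_completions_def)

lemma sidon_completions_image:
  assumes "\<And>p q. f (p + q) = f p + f q"
  shows "f ` sidon_completions S \<subseteq> sidon_completions (f ` S)"
proof
  fix y assume "y \<in> f ` sidon_completions S"
  then obtain p q r where y: "y = f p" and qr: "q \<in> S" "r \<in> S"
    and "p + p = q + r \<or> (\<exists>s\<in>S. p + s = q + r)"
    by (auto simp: sidon_completions_def)
  then have "f p + f p = f q + f r \<or> (\<exists>s\<in>S. f p + f s = f q + f r)"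
    by (metis assms)
  then show "y \<in> sidon_completions (f ` S)"
    using y qr by (auto simp: sidon_completions_def)
qed

lemma sidon_set_insert:
  fixes S :: "'a::cancel_ab_semigroup_add set"
  assumes S: "sidon_set S" and p: "p \<notin> sidon_completions S"
  shows "sidon_set (insert p S)"
proof -
  have "p + s \<noteq> q + r" if "s \<in> insert p S" "q \<in> S" "r \<in> S" for q r s
    using p that unfolding sidon_completions_def by blast
  \<comment> \<open>All other relations involving \<open>p\<close> have it on both sides, where it cancels.\<close>
  then show ?thesis
    using S unfolding sidon_set_def by (metis insert_iff add.commute add_left_cancel)
qed

lemma sidon_completions_lesspoll:
  fixes S :: "'a::real_vector set"
  assumes "infinite X" "S \<prec> X"
  shows "sidon_completions S \<prec> X"
proof -
  let ?midpoints = "(\<lambda>(q, r). (1/2) *\<^sub>R (q + r)) ` (S \<times> S)"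
  let ?fourth_vertices = "(\<lambda>(q, r, s). q + r - s) ` (S \<times> S \<times> S)"
  have "sidon_completions S \<subseteq> ?midpoints \<union> ?fourth_vertices"
  proof
    fix p assume "p \<in> sidon_completions S"
    then obtain q r where qr: "q \<in> S" "r \<in> S" and "p + p = q + r \<or> (\<exists>s\<in>S. p + s = q + r)"
      by (auto simp: sidon_completions_def)
    then consider "p = (1/2) *\<^sub>R (q + r)" | s where "s \<in> S" "p = q + r - s"
      by (metis add_diff_cancel scaleR_half_double)
    then show "p \<in> ?midpoints \<union> ?fourth_vertices"
      by cases (use qr in \<open>force+\<close>)
  qed
  moreover have "?midpoints \<union> ?fourth_vertices \<prec> X"
    using assms by (intro Un_lesspoll_infinite image_lesspoll Times_lesspoll_infinite)
  ultimately show ?thesis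
    using subset_imp_lepoll lesspoll_trans1 by blast
qed

lemma ex_in_open_notin_sidon_completions:
  fixes U S :: "real set"
  assumes "open U" "U \<noteq> {}" "S \<prec> (UNIV :: real set)"
  obtains x where "x \<in> U" "x \<notin> sidon_completions S"
proof -
  have "sidon_completions S \<prec> (UNIV :: real set)"
    using assms(3) by (intro sidon_completions_lesspoll infinite_UNIV_char_0)
  also have "(UNIV :: real set) \<approx> U"
    using open_eqpoll_reals[OF assms(1,2)] by (rule eqpoll_sym)
  finally have "\<not> U \<subseteq> sidon_completions S"
    using subset_imp_lepoll lesspoll_trans2 by blast
  then show ?thesis
    using that by blast
qed

section \<open>Partial bijections with Sidon graph\<close>

definition partial_sidon_bijection ::
    "'a::plus set \<Rightarrow> 'b::plus set \<Rightarrow> ('a \<times> 'b) set \<Rightarrow> bool" where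
  "partial_sidon_bijection A B G \<longleftrightarrow>
     G \<subseteq> A \<times> B \<and> inj_on fst G \<and> inj_on snd G \<and> sidon_set G"

lemma finite_character_partial_sidon_bijection:
  "finite_character (partial_sidon_bijection A B)"
  unfolding partial_sidon_bijection_def
  by (intro finite_character_conj finite_character_subset finite_character_inj_on
      finite_character_sidon_set)

lemma partial_sidon_bijection_insert:
  fixes A :: "'a::cancel_ab_semigroup_add set" and B :: "'b::cancel_ab_semigroup_add set"
  assumes G: "partial_sidon_bijection A B G"
    and x: "x \<in> A" "x \<notin> fst ` G" and y: "y \<in> B" "y \<notin> snd ` G"
    and free: "x \<notin> sidon_completions (fst ` G) \<or> y \<notin> sidon_completions (snd ` G)"
  shows "partial_sidon_bijection A B (insert (x, y) G)"
proof -
  have "(x, y) \<notin> sidon_completions G"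
    using free sidon_completions_image[of fst G] sidon_completions_image[of snd G] by force
  then have "sidon_set (insert (x, y) G)"
    using G sidon_set_insert by (auto simp: partial_sidon_bijection_def)
  then show ?thesis
    using G x y by (auto simp: partial_sidon_bijection_def)
qed

lemma partial_sidon_bijection_insert_with_fst:
  fixes A B :: "real set"
  assumes G: "partial_sidon_bijection A B G" "G \<prec> (UNIV :: real set)"
    and x: "x \<in> A" "x \<notin> fst ` G" and V: "open V" "V \<noteq> {}" "V \<subseteq> B"
  shows "\<exists>y\<in>V. partial_sidon_bijection A B (insert (x, y) G)"
proof -
  obtain y where "y \<in> V" "y \<notin> sidon_completions (snd ` G)"
    using V(1,2) image_lesspoll[OF G(2)] by (rule ex_in_open_notin_sidon_completions)
  then show ?thesis
    using partial_sidon_bijection_insert[OF G(1) x] V(3) subset_sidon_completions by blast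
qed

lemma partial_sidon_bijection_insert_with_snd:
  fixes A B :: "real set"
  assumes G: "partial_sidon_bijection A B G" "G \<prec> (UNIV :: real set)"
    and y: "y \<in> B" "y \<notin> snd ` G" and U: "open U" "U \<noteq> {}" "U \<subseteq> A"
  shows "\<exists>x\<in>U. partial_sidon_bijection A B (insert (x, y) G)"
proof -
  obtain x where "x \<in> U" "x \<notin> sidon_completions (fst ` G)"
    using U(1,2) image_lesspoll[OF G(2)] by (rule ex_in_open_notin_sidon_completions)
  then show ?thesis
    using partial_sidon_bijection_insert[OF G(1) _ _ y] U(3) subset_sidon_completions by blast
qed

lemma partial_sidon_bijection_insert_in_open:
  fixes A B :: "real set"
  assumes G: "partial_sidon_bijection A B G" "G \<prec> (UNIV :: real set)"
    and W: "open W" "W \<noteq> {}" "W \<subseteq> A \<times> B"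
  shows "\<exists>p\<in>W. partial_sidon_bijection A B (insert p G)"
proof -
  obtain U V where UV: "open U" "U \<noteq> {}" "open V" "V \<noteq> {}" "U \<times> V \<subseteq> W"
    using W(1,2) open_prod_elim by (metis all_not_in_conv mem_Times_iff)
  obtain x where "x \<in> U" and "x \<notin> sidon_completions (fst ` G)"
    using UV(1,2) image_lesspoll[OF G(2)] by (rule ex_in_open_notin_sidon_completions)
  moreover have "U \<subseteq> A" "V \<subseteq> B"
    using UV W(3) by blast+
  ultimately have "\<exists>y\<in>V. partial_sidon_bijection A B (insert (x, y) G)"
    using UV(3,4) subset_sidon_completions[of "fst ` G"]
    by (intro partial_sidon_bijection_insert_with_fst[OF G]) auto
  with \<open>x \<in> U\<close> UV(5) show ?thesis
    by blast
qed

definition axis_lines :: "'a set \<Rightarrow> 'b set \<Rightarrow> ('a \<times> 'b) set set" where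
  "axis_lines A B = (\<lambda>x. {x} \<times> B) ` A \<union> (\<lambda>y. A \<times> {y}) ` B"

lemma axis_lines_lepoll: "infinite X \<Longrightarrow> A \<lesssim> X \<Longrightarrow> B \<lesssim> X \<Longrightarrow> axis_lines A B \<lesssim> X"
  unfolding axis_lines_def by (intro Un_lepoll_infinite) (auto intro: lepoll_trans[OF image_lepoll])

lemma meets_axis_lines_imp_projections:
  assumes sub: "G \<subseteq> A \<times> B" and meets: "\<And>L. L \<in> axis_lines A B \<Longrightarrow> G \<inter> L \<noteq> {}"
  shows "fst ` G = A" "snd ` G = B"
proof -
  have "x \<in> fst ` G" if "x \<in> A" for x
    using that meets[of "{x} \<times> B"] by (force simp: axis_lines_def)
  then show "fst ` G = A"
    using sub by auto
  have "y \<in> snd ` G" if "y \<in> B" for y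
    using that meets[of "A \<times> {y}"] by (force simp: axis_lines_def)
  then show "snd ` G = B"
    using sub by auto
qed

lemma partial_sidon_bijection_insert_in_line:
  fixes A B :: "real set"
  assumes G: "partial_sidon_bijection A B G" "G \<prec> (UNIV :: real set)"
    and A: "open A" "A \<noteq> {}" and B: "open B" "B \<noteq> {}" and L: "L \<in> axis_lines A B"
  shows "\<exists>p\<in>L. partial_sidon_bijection A B (insert p G)"
proof (cases "G \<inter> L = {}")
  case False
  then show ?thesis
    using G(1) by (metis disjoint_iff insert_absorb)
next
  case True
  have G_sub: "G \<subseteq> A \<times> B"
    using G(1) by (simp add: partial_sidon_bijection_def)
  consider (vertical) x where "x \<in> A" "L = {x} \<times> B"
    | (horizontal) y where "y \<in> B" "L = A \<times> {y}"
    using L unfolding axis_lines_def by blast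
  then show ?thesis
  proof cases
    case (vertical x)
    then have "x \<notin> fst ` G"
      using True G_sub by force
    then show ?thesis
      using partial_sidon_bijection_insert_with_fst[OF G _ _ B] vertical by auto
  next
    case (horizontal y)
    then have "y \<notin> snd ` G"
      using True G_sub by force
    then show ?thesis
      using partial_sidon_bijection_insert_with_snd[OF G _ _ A] horizontal by auto
  qed
qed

lemma ex_partial_sidon_bijection_meeting:
  fixes A B :: "real set" and \<W> :: "(real \<times> real) set set"
  assumes A: "open A" "A \<noteq> {}" and B: "open B" "B \<noteq> {}" and "countable \<W>"
    and \<W>: "\<And>W. W \<in> \<W> \<Longrightarrow> open W \<and> W \<noteq> {} \<and> W \<subseteq> A \<times> B"
  obtains G where "partial_sidon_bijection A B G" "fst ` G = A" "snd ` G = B"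
    and "\<And>W. W \<in> \<W> \<Longrightarrow> G \<inter> W \<noteq> {}"
proof -
  let ?\<C> = "axis_lines A B \<union> \<W>"
  have \<C>_lepoll: "?\<C> \<lesssim> (UNIV :: real set)"
    using \<open>countable \<W>\<close> infinite_UNIV_char_0
    by (intro Un_lepoll_infinite axis_lines_lepoll countable_lepoll_infinite subset_imp_lepoll) auto
  have extend: "\<exists>p\<in>C. partial_sidon_bijection A B (insert p G)"
    if "C \<in> ?\<C>" and G: "partial_sidon_bijection A B G" and "G \<prec> ?\<C>" for C G
  proof -
    have small: "G \<prec> (UNIV :: real set)"
      using \<open>G \<prec> ?\<C>\<close> \<C>_lepoll by (rule lesspoll_trans2)
    from \<open>C \<in> ?\<C>\<close> show ?thesis
      using partial_sidon_bijection_insert_in_line[OF G small A B]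
        partial_sidon_bijection_insert_in_open[OF G small] \<W> by blast
  qed
  have "partial_sidon_bijection A B {}"
    by (simp add: partial_sidon_bijection_def sidon_set_def)
  from finite_character_partial_sidon_bijection this extend show thesis
  proof (rule transfinite_selection)
    fix G assume G: "partial_sidon_bijection A B G" and meets: "\<And>C. C \<in> ?\<C> \<Longrightarrow> G \<inter> C \<noteq> {}"
    then have "fst ` G = A" "snd ` G = B"
      using meets_axis_lines_imp_projections[of G A B] by (simp_all add: partial_sidon_bijection_def)
    then show thesis
      using that[OF G] meets by blast
  qed
qed

section \<open>Dense graphs\<close>

lemma ex_countable_open_sets_meeting_imp_dense:
  fixes S :: "'a::second_countable_topology set"
  assumes "open S"
  obtains \<W> where "countable \<W>" "\<And>W. W \<in> \<W> \<Longrightarrow> open W \<and> W \<noteq> {} \<and> W \<subseteq> S"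
    and "\<And>G. (\<And>W. W \<in> \<W> \<Longrightarrow> G \<inter> W \<noteq> {}) \<Longrightarrow> S \<subseteq> closure G"
proof -
  obtain \<B> :: "'a set set" where \<B>: "countable \<B>" "topological_basis \<B>"
    using ex_countable_basis by blast
  let ?\<W> = "{W \<in> \<B>. W \<noteq> {} \<and> W \<subseteq> S}"
  show thesis
  proof
    show "countable ?\<W>"
      using \<B>(1) by simp
    show "open W \<and> W \<noteq> {} \<and> W \<subseteq> S" if "W \<in> ?\<W>" for W
      using that topological_basis_open[OF \<B>(2)] by blast
    show "S \<subseteq> closure G" if meets: "\<And>W. W \<in> ?\<W> \<Longrightarrow> G \<inter> W \<noteq> {}" for G
    proof
      fix p assume "p \<in> S"
      show "p \<in> closure G"
        unfolding closure_iff_nhds_not_empty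
      proof (intro allI impI)
        fix N U assume "U \<subseteq> N" "open U" "p \<in> U"
        then obtain W where "W \<in> \<B>" "p \<in> W" "W \<subseteq> U \<inter> S"
          using topological_basisE[OF \<B>(2), of "U \<inter> S" p] \<open>open S\<close> \<open>p \<in> S\<close> by blast
        then show "G \<inter> N \<noteq> {}"
          using meets[of W] \<open>U \<subseteq> N\<close> by blast
      qed
    qed
  qed
qed

lemma continuous_within_closure_graph_eq:
  fixes f :: "'a::t2_space \<Rightarrow> 'b::t2_space"
  assumes cont: "continuous (at x within A) f"
    and closure: "(x, y) \<in> closure {(x, f x) | x. x \<in> A}"
  shows "y = f x"
proof (rule ccontr)
  assume "y \<noteq> f x"
  then obtain V W where V: "open V" "y \<in> V" and W: "open W" "f x \<in> W" and "V \<inter> W = {}"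
    by (metis hausdorff)
  obtain U where U: "open U" "x \<in> U" "\<And>z. z \<in> A \<Longrightarrow> z \<in> U \<Longrightarrow> f z \<in> W"
    using cont W unfolding continuous_within_topological by metis
  have "open (U \<times> V)" "(x, y) \<in> U \<times> V"
    using U V by (auto intro: open_Times)
  then obtain z where "z \<in> A" "z \<in> U" "f z \<in> V"
    using closure unfolding closure_iff_nhds_not_empty by blast
  then show False
    using U(3) \<open>V \<inter> W = {}\<close> by blast
qed

lemma ex_dense_sidon_bijection:
  fixes A B :: "real set"
  assumes A: "open A" "A \<noteq> {}" and B: "open B" "B \<noteq> {}"
  obtains h where "bij_betw h A B" "sidon_set {(x, h x) | x. x \<in> A}"
    and "A \<times> B \<subseteq> closure {(x, h x) | x. x \<in> A}"
proof -
  obtain \<W> where \<W>: "countable \<W>" "\<And>W. W \<in> \<W> \<Longrightarrow> open W \<and> W \<noteq> {} \<and> W \<subseteq> A \<times> B"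
    and dense: "\<And>G. (\<And>W. W \<in> \<W> \<Longrightarrow> G \<inter> W \<noteq> {}) \<Longrightarrow> A \<times> B \<subseteq> closure G"
    using ex_countable_open_sets_meeting_imp_dense[OF open_Times[OF A(1) B(1)]] by blast
  obtain G where G: "partial_sidon_bijection A B G" "fst ` G = A" "snd ` G = B"
    and meets: "\<And>W. W \<in> \<W> \<Longrightarrow> G \<inter> W \<noteq> {}"
    using ex_partial_sidon_bijection_meeting[OF A B \<W>] by blast
  have inj: "inj_on fst G" "inj_on snd G" and "sidon_set G"
    using G(1) by (simp_all add: partial_sidon_bijection_def)
  define h where "h = snd \<circ> inv_into G fst"
  have inv: "bij_betw (inv_into G fst) A G" and "bij_betw snd G B"
    using inj G(2,3) by (auto intro: bij_betw_inv_into simp: bij_betw_imageI)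
  then have "bij_betw h A B"
    unfolding h_def by (rule bij_betw_trans)
  moreover have "G = {(x, h x) | x. x \<in> A}"
  proof -
    have "inv_into G fst x = (x, h x)" if "x \<in> A" for x
      using that G(2) by (simp add: h_def prod_eq_iff f_inv_into_f)
    then show ?thesis
      using bij_betw_imp_surj_on[OF inv] by (force simp: Setcompr_eq_image)
  qed
  ultimately show thesis
    using that \<open>sidon_set G\<close> dense[OF meets] by blast
qed

section \<open>Costas clouds\<close>

lemma costas_property_iff_sidon_set:
  "costas_property (costas_translations A) A f \<longleftrightarrow> sidon_set {(x, f x) | x. x \<in> A}"
proof
  assume costas: "costas_property (costas_translations A) A f"
  have "p = q \<or> p = r" if "p \<in> A" "q \<in> A" "r \<in> A" "s \<in> A"
    and sum: "p + s = q + r" "f p + f s = f q + f r" for p q r s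
  proof (cases "p = r")
    case False
    have "r + (p - r) = p" "s + (p - r) = q"
      using sum(1) by auto
    moreover from this have "p - r \<in> costas_translations A"
      using that False by (force simp: costas_translations_def image_iff)
    ultimately have "r = s"
      using costas that unfolding costas_property_def by (metis add.commute)
    then show ?thesis
      using sum(1) by simp
  qed simp
  then show "sidon_set {(x, f x) | x. x \<in> A}"
    unfolding sidon_set_def by auto
next
  assume sidon: "sidon_set {(x, f x) | x. x \<in> A}"
  show "costas_property (costas_translations A) A f"
    unfolding costas_property_def
  proof (intro ballI impI)
    fix a b t
    assume in_A: "a \<in> A" "b \<in> A" "t + a \<in> A" "t + b \<in> A" and "t \<in> costas_translations A"
      and "f (t + a) + f b = f (t + b) + f a"
    then have "(t + a, f (t + a)) + (b, f b) = (t + b, f (t + b)) + (a, f a)"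
      by simp
    then have "t + a = t + b \<or> t + a = a"
      using sidon in_A unfolding sidon_set_def by blast
    then show "a = b"
      using \<open>t \<in> costas_translations A\<close> by (simp add: costas_translations_def)
  qed
qed

lemma bijective_costas_cloudI:
  assumes "is_interval A" "is_interval B" and B: "\<And>y. B \<noteq> {y}"
    and bij: "bij_betw f A B" and sidon: "sidon_set {(x, f x) | x. x \<in> A}"
    and dense: "A \<times> B \<subseteq> closure {(x, f x) | x. x \<in> A}"
  shows "bijective_costas_cloud A B f"
proof -
  have "\<not> continuous (at x within A) f" if "x \<in> A" for x
  proof
    assume cont: "continuous (at x within A) f"
    have "f x \<in> B"
      using bij that by (rule bij_betwE[THEN bspec])
    then obtain y where "y \<in> B" "y \<noteq> f x"
      using B by blast
    then show False
      using continuous_within_closure_graph_eq[OF cont] dense that by blast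
  qed
  then show ?thesis
    using assms by (auto simp: bijective_costas_cloud_def costas_cloud_def bij_betw_def
        costas_property_iff_sidon_set)
qed

lemma ex_bijective_costas_cloud_open_intervals:
  assumes A: "open A" "A \<noteq> {}" "is_interval A" and B: "open B" "B \<noteq> {}" "is_interval B"
  shows "\<exists>h. bijective_costas_cloud A B h"
proof -
  obtain h where "bij_betw h A B" "sidon_set {(x, h x) | x. x \<in> A}"
    and "A \<times> B \<subseteq> closure {(x, h x) | x. x \<in> A}"
    using ex_dense_sidon_bijection[OF A(1,2) B(1,2)] by blast
  moreover have "B \<noteq> {y}" for y
    using B(1) not_open_singleton by blast
  ultimately show ?thesis
    using bijective_costas_cloudI[OF A(3) B(3)] by blast
qed

theorem theorem13:
  shows "\<exists>h :: real \<Rightarrow> real. bijective_costas_cloud UNIV {0<..<1} h"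
  by (rule ex_bijective_costas_cloud_open_intervals) simp_all

end
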